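(* Let $\alpha \in \mathbb{R}$, let $(X, c_t)$ be a labelled data set with $X \subseteq \mathbb{R}^d$ finite and nonempty, and let $C$ be a finite nonempty set of classifiers. For every randomized attack $(A, \mathbb{P})$ there exists a randomized attack $(A', \mathbb{P}')$ such that 1. $|A'| \leq (|X|+1)^{|C|}$, 2. $\mathbf{Val}(A', \mathbb{P}') = \mathbf{Val}(A, \mathbb{P})$ (both values taken with respect to $(X,c_t)$ and $C$), and 3. for every real $\varepsilon \ge 0$, $(A', \mathbb{P}')$ is $\varepsilon$-bounded if $(A, \mathbb{P})$ is $\varepsilon$-bounded.
   Context: Fix a dimension $d \ge 1$ and a number of labels $\ell \geq 1$; the set of labels is $[\ell] = \{1,\dots,\ell\}$. A data set is a finite set $X \subseteq \mathbb{R}^d$. A classifier is a partial function $c$ from $\mathbb{R}^d$ to $[\ell]$. A labelled data set $(X, c_t)$ consists of a data set $X$ and a total function $c_t \colon X \to [\ell]$ (the ground truth). A deterministic attack is a function $\delta \colon X \to \mathbb{R}^d$. A randomized attack $(A,\mathbb{P})$ consists of a finite set $A$ of deterministic attacks and a probability distribution $\mathbb{P}\colon A \to [0,1]$, $\sum_{\delta \in A}\mathbb{P}(\delta) = 1$. It is $\varepsilon$-bounded if for all $\delta \in A$ with $\mathbb{P}(\delta) > 0$ and all $\mathbf{x} \in X$ we have $\|\delta(\mathbf{x})\|_1 \leq \varepsilon$, where $\|\mathbf{x}\|_1 = \sum_{i=1}^d |x_i|$. The zero-one loss $\ell_{0-1}(c, \mathbf{x}, \delta(\mathbf{x}))$ is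 $0$ if $c(\mathbf{x}+\delta(\mathbf{x}))$ is defined and equal to $c_t(\mathbf{x})$, and $1$ otherwise (in particular it is $1$ if $c(\mathbf{x}+\delta(\mathbf{x}))$ is undefined). The misclassification value of $(A,\mathbb{P})$ with respect to $(X,c_t)$ and a finite set $C$ of classifiers is $$\mathbf{Val}(A,\mathbb{P}) = \min_{c \in C} \frac{1}{|X|} \sum_{\mathbf{x} \in X} \sum_{\delta \in A} \mathbb{P}(\delta)\, \ell_{0-1}(c,\mathbf{x},\delta(\mathbf{x})).$$ *)

theory Defs
  imports "HOL-Analysis.Analysis"
begin

definition is_classifier :: "nat \<Rightarrow> (real ^ 'd \<rightharpoonup> nat) \<Rightarrow> bool" where
  "is_classifier l c \<longleftrightarrow> ran c \<subseteq> {1..l}"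

definition labelled_data_set :: "nat \<Rightarrow> (real ^ 'd) set \<Rightarrow> (real ^ 'd \<Rightarrow> nat) \<Rightarrow> bool" where
  "labelled_data_set l X ct \<longleftrightarrow> finite X \<and> ct \<in> X \<rightarrow> {1..l}"

(* Attacks have domain X, so they are extensional: HOL equality of attacks is then
   equality as functions on X, and card of a set of attacks counts them as such. *)
definition deterministic_attacks :: "(real ^ 'd) set \<Rightarrow> (real ^ 'd \<Rightarrow> real ^ 'd) set" where
  "deterministic_attacks X = X \<rightarrow>\<^sub>E UNIV"

(* The probability function pr is only relevant on A. *)
definition randomized_attack ::
    "(real ^ 'd) set \<Rightarrow> (real ^ 'd \<Rightarrow> real ^ 'd) set \<Rightarrow> ((real ^ 'd \<Rightarrow> real ^ 'd) \<Rightarrow> real) \<Rightarrow> bool" where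
  "randomized_attack X A pr \<longleftrightarrow>
     finite A \<and> A \<subseteq> deterministic_attacks X \<and> pr \<in> A \<rightarrow> {0..1} \<and> (\<Sum>\<delta>\<in>A. pr \<delta>) = 1"

definition norm1 :: "real ^ 'd \<Rightarrow> real" where
  "norm1 x = (\<Sum>i\<in>UNIV. \<bar>x $ i\<bar>)"

definition eps_bounded ::
    "real \<Rightarrow> (real ^ 'd) set \<Rightarrow> (real ^ 'd \<Rightarrow> real ^ 'd) set \<Rightarrow> ((real ^ 'd \<Rightarrow> real ^ 'd) \<Rightarrow> real) \<Rightarrow> bool" where
  "eps_bounded \<epsilon> X A pr \<longleftrightarrow> (\<forall>\<delta>\<in>A. pr \<delta> > 0 \<longrightarrow> (\<forall>x\<in>X. norm1 (\<delta> x) \<le> \<epsilon>))"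

definition zero_one_loss ::
    "(real ^ 'd \<Rightarrow> nat) \<Rightarrow> (real ^ 'd \<rightharpoonup> nat) \<Rightarrow> real ^ 'd \<Rightarrow> real ^ 'd \<Rightarrow> real" where
  "zero_one_loss ct c x v = (if c (x + v) = Some (ct x) then 0 else 1)"

definition misclassification_value ::
    "(real ^ 'd) set \<Rightarrow> (real ^ 'd \<Rightarrow> nat) \<Rightarrow> (real ^ 'd \<rightharpoonup> nat) set \<Rightarrow>
     (real ^ 'd \<Rightarrow> real ^ 'd) set \<Rightarrow> ((real ^ 'd \<Rightarrow> real ^ 'd) \<Rightarrow> real) \<Rightarrow> real" where
  "misclassification_value X ct C A pr =
     (MIN c\<in>C. 1 / real (card X) * (\<Sum>x\<in>X. \<Sum>\<delta>\<in>A. pr \<delta> * zero_one_loss ct c x (\<delta> x)))"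

end

theory Submission
  imports Defs
begin

text \<open>
  The expected loss of a classifier \<open>c\<close> under an attack \<open>\<delta>\<close> depends only on the number of points
  that \<open>c\<close> misclassifies under \<open>\<delta>\<close>. So attacks with the same profile of misclassification counts
  can be merged into one of them, which receives their total probability. There are at most
  \<open>(card X + 1) ^ card C\<close> profiles. Attacks of probability \<open>0\<close> are discarded beforehand, since the
  representative of a profile must itself obey the bound on \<open>\<epsilon>\<close>.
\<close>

definition misclassified_count ::
    "(real ^ 'd) set \<Rightarrow> (real ^ 'd \<Rightarrow> nat) \<Rightarrow> (real ^ 'd \<rightharpoonup> nat) \<Rightarrow> (real ^ 'd \<Rightarrow> real ^ 'd) \<Rightarrow> nat" where
  "misclassified_count X ct c \<delta> = card {x \<in> X. c (x + \<delta> x) \<noteq> Some (ct x)}"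

lemma misclassified_count_le: "finite X \<Longrightarrow> misclassified_count X ct c \<delta> \<le> card X"
  unfolding misclassified_count_def by (rule card_mono) auto

lemma sum_zero_one_loss:
  assumes "finite X"
  shows "(\<Sum>x\<in>X. zero_one_loss ct c x (\<delta> x)) = real (misclassified_count X ct c \<delta>)"
proof -
  have "(\<Sum>x\<in>X. zero_one_loss ct c x (\<delta> x)) =
      (\<Sum>x\<in>X. if c (x + \<delta> x) \<noteq> Some (ct x) then 1 else 0)"
    by (intro sum.cong) (auto simp: zero_one_loss_def)
  also have "\<dots> = real (misclassified_count X ct c \<delta>)"
    using assms by (simp add: misclassified_count_def sum.inter_filter [symmetric] del: not_None_eq)
  finally show ?thesis .
qed

text \<open>Exchanging the two sums collects, for each attack, its losses over all of
  \<open>X\<close>; they add up to its count.\<close>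

lemma misclassification_value_eq:
  assumes "finite X"
  shows "misclassification_value X ct C A pr =
    (MIN c\<in>C. 1 / real (card X) * (\<Sum>\<delta>\<in>A. pr \<delta> * real (misclassified_count X ct c \<delta>)))"
proof -
  have "(\<Sum>x\<in>X. \<Sum>\<delta>\<in>A. pr \<delta> * zero_one_loss ct c x (\<delta> x)) =
      (\<Sum>\<delta>\<in>A. pr \<delta> * real (misclassified_count X ct c \<delta>))" for c
    by (subst sum.swap) (simp add: sum_distrib_left [symmetric] sum_zero_one_loss [OF assms])
  then show ?thesis
    by (simp add: misclassification_value_def)
qed

text \<open>Change of variables for the image of the weights \<open>p\<close> under
  \<open>s\<close>: group the sum by the fibres of \<open>s\<close>, on each of which
  \<open>g (s x)\<close> is constant.\<close>

lemma sum_pushforward: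
  fixes p :: "'a \<Rightarrow> 'c::semiring_0"
  assumes "finite B"
  shows "(\<Sum>y\<in>s ` B. (\<Sum>x\<in>{x\<in>B. s x = y}. p x) * g y) = (\<Sum>x\<in>B. p x * g (s x))"
proof -
  have "(\<Sum>x\<in>B. p x * g (s x)) = (\<Sum>y\<in>s ` B. \<Sum>x\<in>{x\<in>B. s x = y}. p x * g (s x))"
    using assms by (rule sum.image_gen)
  also have "\<dots> = (\<Sum>y\<in>s ` B. (\<Sum>x\<in>{x\<in>B. s x = y}. p x) * g y)"
    by (simp add: sum_distrib_right)
  finally show ?thesis by simp
qed

theorem proposition1:
  fixes \<alpha> :: real
    and l :: nat
    and X :: "(real ^ 'd) set"
    and ct :: "real ^ 'd \<Rightarrow> nat"
    and C :: "(real ^ 'd \<rightharpoonup> nat) set"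
    and A :: "(real ^ 'd \<Rightarrow> real ^ 'd) set"
    and pr :: "(real ^ 'd \<Rightarrow> real ^ 'd) \<Rightarrow> real"
  assumes "1 \<le> l"
    and "labelled_data_set l X ct" and "X \<noteq> {}"
    and "finite C" and "C \<noteq> {}" and "\<forall>c\<in>C. is_classifier l c"
    and "randomized_attack X A pr"
  shows "\<exists>A' pr'. randomized_attack X A' pr' \<and>
           card A' \<le> (card X + 1) ^ card C \<and>
           misclassification_value X ct C A' pr' = misclassification_value X ct C A pr \<and>
           (\<forall>\<epsilon>\<ge>0. eps_bounded \<epsilon> X A pr \<longrightarrow> eps_bounded \<epsilon> X A' pr')"
proof -
  have finX: "finite X"
    using assms(2) by (simp add: labelled_data_set_def)
  have A: "finite A" "A \<subseteq> deterministic_attacks X" "\<And>\<delta>. \<delta> \<in> A \<Longrightarrow> 0 \<le> pr \<delta>" "sum pr A = 1"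
    using assms(7) by (auto simp: randomized_attack_def Pi_iff)
  define B where "B = {\<delta> \<in> A. pr \<delta> > 0}"
  have finB: "finite B" and "B \<subseteq> A"
    using A(1) by (auto simp: B_def)
  \<comment> \<open>The attacks in \<open>A - B\<close> have probability exactly \<open>0\<close>,
    so they contribute nothing to any weighted sum.\<close>
  have sumB: "(\<Sum>\<delta>\<in>B. pr \<delta> * g \<delta>) = (\<Sum>\<delta>\<in>A. pr \<delta> * g \<delta>)" for g :: "_ \<Rightarrow> real"
    by (rule sum.mono_neutral_left) (use A(1,3) in \<open>auto simp: B_def less_eq_real_def\<close>)
  \<comment> \<open>Restricting to \<open>C\<close> places profiles in an extensional function
    space, which is finite and can be counted.\<close>
  define profile where "profile \<delta> = (\<lambda>c\<in>C. misclassified_count X ct c \<delta>)" for \<delta>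
  \<comment> \<open>\<open>rep\<close> picks one attack of \<open>B\<close> for each profile that
    occurs; \<open>s\<close> sends an attack to the representative of its class.\<close>
  define rep where "rep = inv_into B profile"
  define s where "s = rep \<circ> profile"
  have s_mem: "s \<delta> \<in> B" if "\<delta> \<in> B" for \<delta>
    using that by (simp add: s_def rep_def inv_into_into)
  have "profile (s \<delta>) = profile \<delta>" if "\<delta> \<in> B" for \<delta>
    using that by (simp add: s_def rep_def f_inv_into_f)
  then have s_count: "misclassified_count X ct c (s \<delta>) = misclassified_count X ct c \<delta>"
    if "\<delta> \<in> B" "c \<in> C" for \<delta> c
    using that by (metis profile_def restrict_apply')
  define A' where "A' = s ` B"
  define pr' where "pr' \<delta>' = (\<Sum>\<delta>\<in>{\<delta>\<in>B. s \<delta> = \<delta>'}. pr \<delta>)" for \<delta>'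
  have A'_sub: "A' \<subseteq> B"
    using s_mem by (auto simp: A'_def)
  have sum': "(\<Sum>\<delta>\<in>A'. pr' \<delta> * g \<delta>) = (\<Sum>\<delta>\<in>B. pr \<delta> * g (s \<delta>))" for g :: "_ \<Rightarrow> real"
    unfolding A'_def pr'_def by (rule sum_pushforward [OF finB])
  \<comment> \<open>The constant function \<open>1\<close> as \<open>g\<close> turns both sum
    identities into statements about total mass.\<close>
  have total: "sum pr' A' = 1"
    using sum' [of "\<lambda>_. 1"] sumB [of "\<lambda>_. 1"] A(4) by simp
  have fin': "finite A'"
    using finB by (simp add: A'_def)
  have nonneg: "0 \<le> pr' \<delta>" for \<delta>
    unfolding pr'_def by (rule sum_nonneg) (auto simp: B_def)
  have "pr' \<delta> \<le> 1" if "\<delta> \<in> A'" for \<delta>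
    using member_le_sum [OF that, of pr'] nonneg fin' total by simp
  then have "randomized_attack X A' pr'"
    using fin' A'_sub \<open>B \<subseteq> A\<close> A(2) nonneg total by (auto simp: randomized_attack_def)
  moreover have "card A' \<le> (card X + 1) ^ card C"
  proof -
    \<comment> \<open>A count takes one of the \<open>card X + 1\<close> values from
      \<open>0\<close> to \<open>card X\<close>; this is the base of the power.\<close>
    have "profile ` B \<subseteq> C \<rightarrow>\<^sub>E {0..card X}"
      using misclassified_count_le [OF finX] by (auto simp: profile_def)
    then have "card (profile ` B) \<le> card (C \<rightarrow>\<^sub>E {0..card X})"
      by (intro card_mono finite_PiE) (use assms(4) in auto)
    also have "\<dots> = (card X + 1) ^ card C"
      using assms(4) by (simp add: card_PiE)
    \<comment> \<open>\<open>A'\<close> is the image of the occurring profiles under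
      \<open>rep\<close>, so it has at most as many elements.\<close>
    finally show ?thesis
      using card_image_le [of "profile ` B" rep] finB by (simp add: A'_def s_def image_comp)
  qed
  moreover have "misclassification_value X ct C A' pr' = misclassification_value X ct C A pr"
  proof -
    \<comment> \<open>The sums agree for each \<open>c\<close> in \<open>C\<close> separately,
      because \<open>s\<close> preserves the counts of these classifiers; hence the minima
      agree.\<close>
    have "(\<Sum>\<delta>\<in>A'. pr' \<delta> * real (misclassified_count X ct c \<delta>)) =
        (\<Sum>\<delta>\<in>A. pr \<delta> * real (misclassified_count X ct c \<delta>))" if "c \<in> C" for c
      unfolding sum' using that by (simp add: s_count flip: sumB)
    then show ?thesis
      by (simp add: misclassification_value_eq [OF finX] cong: image_cong)
  qed
  \<comment> \<open>Each representative lies in \<open>B\<close>, so it has positive probability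
    under \<open>pr\<close> and the bound already applies to it.\<close>
  moreover have "eps_bounded \<epsilon> X A' pr'" if "eps_bounded \<epsilon> X A pr" for \<epsilon>
    using that A'_sub by (auto simp: eps_bounded_def B_def)
  ultimately show ?thesis by blast
qed

end
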